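(* Let $G_1,G_2$ be finite abelian groups with $|G_2|=|G_1|+1=n$, where $n\geqslant 3$, let $\varphi:G_1\to G_2$ be a map and let $D=\{(i,\varphi(i)) : i\in G_1\}\subseteq G_1\times G_2$. Then $D$ is a direct product difference set of order $n$ in $G_1\times G_2$ if and only if $\varphi$ is a circular Costas map.
   Context: Let $G=A\times B$ be a direct product of groups written additively, with $|A|=n-1$ and $|B|=n$, $n\geqslant 3$. A subset $D\subseteq G$ is a direct product difference set of order $n$ in $G$ if every element of $G\setminus\big((A\times\{0\})\cup(\{0\}\times B)\big)$ can be written in exactly one way as $d_j-d_i$ with $d_i,d_j\in D$, and no nonidentity element of $(A\times\{0\})\cup(\{0\}\times B)$ can be written as such a difference. For finite abelian groups $G_1,G_2$ with $|G_1|+1=|G_2|$, a map $\varphi:G_1\to G_2$ is circular Costas if $\varphi$ is injective and, for every $k\in G_1\setminus\{0\}$, the map $i\mapsto\varphi(i+k)-\varphi(i)$ from $G_1$ to $G_2$ is injective. *)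

theory Defs
  imports "HOL-Algebra.Coset"
begin

(* Groups are written multiplicatively here: the difference d' - d is d' \<otimes> inv d and 0 is \<one>. *)

(* "In exactly one way" counts ordered pairs (d, d') of elements of D.
   The groups need not be abelian. *)
definition direct_product_difference_set ::
  "('a, 'm) monoid_scheme \<Rightarrow> ('b, 'k) monoid_scheme \<Rightarrow> nat \<Rightarrow> ('a \<times> 'b) set \<Rightarrow> bool"
where
  "direct_product_difference_set A B n D \<longleftrightarrow>
     (let G = A \<times>\<times> B;
          E = (carrier A \<times> {\<one>\<^bsub>B\<^esub>}) \<union> ({\<one>\<^bsub>A\<^esub>} \<times> carrier B)
      in group A \<and> group B \<and>
         finite (carrier A) \<and> finite (carrier B) \<and>
         n \<ge> 3 \<and> order A = n - 1 \<and> order B = n \<and>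
         D \<subseteq> carrier G \<and>
         (\<forall>g \<in> carrier G - E.
            \<exists>!p. p \<in> D \<times> D \<and> g = snd p \<otimes>\<^bsub>G\<^esub> inv\<^bsub>G\<^esub> fst p) \<and>
         (\<forall>g \<in> E - {\<one>\<^bsub>G\<^esub>}.
            \<not> (\<exists>d \<in> D. \<exists>d' \<in> D. g = d' \<otimes>\<^bsub>G\<^esub> inv\<^bsub>G\<^esub> d)))"

definition circular_costas ::
  "('a, 'm) monoid_scheme \<Rightarrow> ('b, 'k) monoid_scheme \<Rightarrow> ('a \<Rightarrow> 'b) \<Rightarrow> bool"
where
  "circular_costas G1 G2 \<phi> \<longleftrightarrow>
     comm_group G1 \<and> comm_group G2 \<and>
     finite (carrier G1) \<and> finite (carrier G2) \<and>
     order G1 + 1 = order G2 \<and>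
     \<phi> \<in> carrier G1 \<rightarrow> carrier G2 \<and>
     inj_on \<phi> (carrier G1) \<and>
     (\<forall>k \<in> carrier G1 - {\<one>\<^bsub>G1\<^esub>}.
        inj_on (\<lambda>i. \<phi> (i \<otimes>\<^bsub>G1\<^esub> k) \<otimes>\<^bsub>G2\<^esub> inv\<^bsub>G2\<^esub> (\<phi> i)) (carrier G1))"

end

theory Submission
  imports Defs
begin

text \<open>A representation of \<open>(k, b)\<close> as a difference of two elements of the graph of \<open>\<phi>\<close> is the
same as an \<open>i\<close> with \<open>\<phi> (i + k) - \<phi> i = b\<close>. If \<open>\<phi>\<close> is injective and \<open>k \<noteq> 0\<close>, the map
\<open>i \<mapsto> \<phi> (i + k) - \<phi> i\<close> takes its values in the nonzero elements of \<open>G2\<close>, a set with as many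
elements as \<open>G1\<close>; hence it is injective iff every nonzero \<open>b\<close> is attained exactly once.\<close>

text \<open>An injective map into a finite set of the same size is onto, so existence comes from
  counting and uniqueness from injectivity. Conversely, \<open>sub\<close> puts every value of
  \<open>f\<close> in the range of the quantifier over \<open>B\<close>, so no value is taken
  twice.\<close>

lemma inj_on_iff_ex1:
  assumes "finite B" and "card B = card A" and sub: "f ` A \<subseteq> B"
  shows "inj_on f A \<longleftrightarrow> (\<forall>b\<in>B. \<exists>!a. a \<in> A \<and> f a = b)"
proof
  assume inj: "inj_on f A"
  then have "f ` A = B"
    using assms by (intro card_subset_eq) (auto simp: card_image)
  then show "\<forall>b\<in>B. \<exists>!a. a \<in> A \<and> f a = b"
    using inj unfolding inj_on_def by blast
next
  assume "\<forall>b\<in>B. \<exists>!a. a \<in> A \<and> f a = b"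
  then show "inj_on f A"
    using sub unfolding inj_on_def by blast
qed

text \<open>Since \<open>D\<close> is a graph, a pair in \<open>D \<times> D\<close> amounts to two
  arguments \<open>i\<close> and \<open>j\<close>. The first coordinate of the difference forces
  \<open>j = i + k\<close>, which leaves \<open>i\<close> as the only free parameter, and the second
  coordinate becomes the Costas difference.\<close>

lemma graph_difference_iff:
  fixes G1 :: "('a, 'm) monoid_scheme" and G2 :: "('b, 'k) monoid_scheme"
  assumes "comm_group G1" and "group G2" and "\<phi> \<in> carrier G1 \<rightarrow> carrier G2"
    and "k \<in> carrier G1"
    and D: "D = {(i, \<phi> i) | i. i \<in> carrier G1}"
  shows "p \<in> D \<times> D \<and> (k, b) = snd p \<otimes>\<^bsub>G1 \<times>\<times> G2\<^esub> inv\<^bsub>G1 \<times>\<times> G2\<^esub> fst p \<longleftrightarrow>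
    (\<exists>i \<in> carrier G1. p = ((i, \<phi> i), (i \<otimes>\<^bsub>G1\<^esub> k, \<phi> (i \<otimes>\<^bsub>G1\<^esub> k))) \<and>
      \<phi> (i \<otimes>\<^bsub>G1\<^esub> k) \<otimes>\<^bsub>G2\<^esub> inv\<^bsub>G2\<^esub> \<phi> i = b)"
    (is "?L \<longleftrightarrow> ?R")
proof -
  interpret G1: comm_group G1 by fact
  interpret G2: group G2 by fact
  have \<phi>: "\<phi> i \<in> carrier G2" if "i \<in> carrier G1" for i
    using assms(3) that by blast
  have diff: "(j, \<phi> j) \<otimes>\<^bsub>G1 \<times>\<times> G2\<^esub> inv\<^bsub>G1 \<times>\<times> G2\<^esub> (i, \<phi> i)
      = (j \<otimes>\<^bsub>G1\<^esub> inv\<^bsub>G1\<^esub> i, \<phi> j \<otimes>\<^bsub>G2\<^esub> inv\<^bsub>G2\<^esub> \<phi> i)" if "i \<in> carrier G1" for i j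
    using that \<phi> by (simp add: inv_DirProd G1.group_axioms G2.group_axioms)
  \<comment> \<open>In general \<open>k = j - i\<close> only yields \<open>j = k + i\<close>;
    commutativity of \<open>G1\<close> turns this into the form \<open>i + k\<close> used in
    \<open>circular_costas\<close>.\<close>
  have solve: "k = j \<otimes>\<^bsub>G1\<^esub> inv\<^bsub>G1\<^esub> i \<longleftrightarrow> j = i \<otimes>\<^bsub>G1\<^esub> k"
    if "i \<in> carrier G1" "j \<in> carrier G1" for i j
    using that assms(4) by (metis G1.inv_solve_right G1.m_comm)
  show ?thesis
  proof
    assume L: ?L
    then obtain i j where "i \<in> carrier G1" "j \<in> carrier G1" "p = ((i, \<phi> i), (j, \<phi> j))"
      using D by auto
    with L show ?R by (auto simp: diff solve)
  next
    assume ?R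
    then obtain i where i: "i \<in> carrier G1"
      and p: "p = ((i, \<phi> i), (i \<otimes>\<^bsub>G1\<^esub> k, \<phi> (i \<otimes>\<^bsub>G1\<^esub> k)))"
      and b: "\<phi> (i \<otimes>\<^bsub>G1\<^esub> k) \<otimes>\<^bsub>G2\<^esub> inv\<^bsub>G2\<^esub> \<phi> i = b"
      by blast
    have j: "i \<otimes>\<^bsub>G1\<^esub> k \<in> carrier G1"
      using i assms(4) by simp
    have "k = (i \<otimes>\<^bsub>G1\<^esub> k) \<otimes>\<^bsub>G1\<^esub> inv\<^bsub>G1\<^esub> i"
      using solve[OF i j] by simp
    then show ?L
      using i j b unfolding p D by (auto simp: diff)
  qed
qed

text \<open>Both clauses of the definition are sorted by the first coordinate \<open>k\<close> of
  the difference. For a graph, the forbidden elements \<open>(0, b)\<close> with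
  \<open>b \<noteq> 0\<close> are excluded automatically, so only the elements \<open>(k, 0)\<close>
  with \<open>k \<noteq> 0\<close> impose a condition.\<close>

lemma direct_product_difference_set_graph_iff:
  fixes G1 :: "('a, 'm) monoid_scheme" and G2 :: "('b, 'k) monoid_scheme"
  assumes "comm_group G1" and "finite (carrier G1)" and "group G2" and "finite (carrier G2)"
    and "order G2 = order G1 + 1" and "order G2 = n" and "n \<ge> 3"
    and \<phi>: "\<phi> \<in> carrier G1 \<rightarrow> carrier G2"
    and D: "D = {(i, \<phi> i) | i. i \<in> carrier G1}"
  shows "direct_product_difference_set G1 G2 n D \<longleftrightarrow>
    (\<forall>k \<in> carrier G1 - {\<one>\<^bsub>G1\<^esub>}.
      (\<forall>i \<in> carrier G1. \<phi> (i \<otimes>\<^bsub>G1\<^esub> k) \<otimes>\<^bsub>G2\<^esub> inv\<^bsub>G2\<^esub> \<phi> i \<noteq> \<one>\<^bsub>G2\<^esub>) \<and>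
      (\<forall>b \<in> carrier G2 - {\<one>\<^bsub>G2\<^esub>}.
        \<exists>!i. i \<in> carrier G1 \<and> \<phi> (i \<otimes>\<^bsub>G1\<^esub> k) \<otimes>\<^bsub>G2\<^esub> inv\<^bsub>G2\<^esub> \<phi> i = b))"
proof -
  interpret G1: comm_group G1 by fact
  interpret G2: group G2 by fact
  let ?G = "G1 \<times>\<times> G2"
  let ?E = "(carrier G1 \<times> {\<one>\<^bsub>G2\<^esub>}) \<union> ({\<one>\<^bsub>G1\<^esub>} \<times> carrier G2)"
  let ?\<Delta> = "\<lambda>k i. \<phi> (i \<otimes>\<^bsub>G1\<^esub> k) \<otimes>\<^bsub>G2\<^esub> inv\<^bsub>G2\<^esub> \<phi> i"
  let ?rep = "\<lambda>g p. p \<in> D \<times> D \<and> g = snd p \<otimes>\<^bsub>?G\<^esub> inv\<^bsub>?G\<^esub> fst p"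
  let ?dif = "\<lambda>g. \<exists>d\<in>D. \<exists>d'\<in>D. g = d' \<otimes>\<^bsub>?G\<^esub> inv\<^bsub>?G\<^esub> d"
  have \<phi>_closed: "\<phi> i \<in> carrier G2" if "i \<in> carrier G1" for i
    using \<phi> that by blast
  have rep: "?rep (k, b) p \<longleftrightarrow> (\<exists>i \<in> carrier G1.
      p = ((i, \<phi> i), (i \<otimes>\<^bsub>G1\<^esub> k, \<phi> (i \<otimes>\<^bsub>G1\<^esub> k))) \<and> ?\<Delta> k i = b)"
    if "k \<in> carrier G1" for k b p
    using graph_difference_iff[OF \<open>comm_group G1\<close> \<open>group G2\<close> \<phi> that D] .
  \<comment> \<open>The pair \<open>p\<close> built from \<open>i\<close> has \<open>i\<close> as
    its very first entry, so distinct \<open>i\<close> give distinct \<open>p\<close> and uniqueness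
    transfers both ways.\<close>
  have unique: "(\<exists>!p. ?rep (k, b) p) \<longleftrightarrow> (\<exists>!i. i \<in> carrier G1 \<and> ?\<Delta> k i = b)"
    if "k \<in> carrier G1" for k b
    unfolding rep[OF that] by (rule iffI; blast)
  have exists: "?dif (k, b) \<longleftrightarrow> (\<exists>i \<in> carrier G1. ?\<Delta> k i = b)"
    (is "?lhs \<longleftrightarrow> _") if "k \<in> carrier G1" for k b
  proof -
    have "?lhs \<longleftrightarrow> (\<exists>p. ?rep (k, b) p)" by fastforce
    also have "\<dots> \<longleftrightarrow> (\<exists>i \<in> carrier G1. ?\<Delta> k i = b)" unfolding rep[OF that] by blast
    finally show ?thesis .
  qed
  have "D \<subseteq> carrier ?G" using D \<phi>_closed by auto
  then have "direct_product_difference_set G1 G2 n D \<longleftrightarrow>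
      (\<forall>g \<in> carrier ?G - ?E. \<exists>!p. ?rep g p) \<and>
      (\<forall>g \<in> ?E - {\<one>\<^bsub>?G\<^esub>}. \<not> ?dif g)"
    using assms(2,4-7) G1.group_axioms G2.group_axioms
    unfolding direct_product_difference_set_def Let_def by simp
  also have "(\<forall>g \<in> carrier ?G - ?E. \<exists>!p. ?rep g p) \<longleftrightarrow>
      (\<forall>k \<in> carrier G1 - {\<one>\<^bsub>G1\<^esub>}. \<forall>b \<in> carrier G2 - {\<one>\<^bsub>G2\<^esub>}.
        \<exists>!i. i \<in> carrier G1 \<and> ?\<Delta> k i = b)"
  proof -
    have "carrier ?G - ?E = (carrier G1 - {\<one>\<^bsub>G1\<^esub>}) \<times> (carrier G2 - {\<one>\<^bsub>G2\<^esub>})" by auto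
    then show ?thesis using unique by (simp add: ball_simps)
  qed
  also have "(\<forall>g \<in> ?E - {\<one>\<^bsub>?G\<^esub>}. \<not> ?dif g) \<longleftrightarrow>
      (\<forall>k \<in> carrier G1 - {\<one>\<^bsub>G1\<^esub>}. \<forall>i \<in> carrier G1. ?\<Delta> k i \<noteq> \<one>\<^bsub>G2\<^esub>)"
  proof -
    have E: "?E - {\<one>\<^bsub>?G\<^esub>} = (carrier G1 - {\<one>\<^bsub>G1\<^esub>}) \<times> {\<one>\<^bsub>G2\<^esub>} \<union>
        {\<one>\<^bsub>G1\<^esub>} \<times> (carrier G2 - {\<one>\<^bsub>G2\<^esub>})" by auto
    \<comment> \<open>A difference with first coordinate 0 subtracts a point of the graph from
      itself, so its second coordinate is 0 as well.\<close>
    have "?\<Delta> \<one>\<^bsub>G1\<^esub> i = \<one>\<^bsub>G2\<^esub>" if "i \<in> carrier G1" for i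
      using that \<phi>_closed by simp
    then have one: "\<not> ?dif (\<one>\<^bsub>G1\<^esub>, b)" if "b \<noteq> \<one>\<^bsub>G2\<^esub>" for b
      unfolding exists[OF G1.one_closed] using that by metis
    \<comment> \<open>Stated for an arbitrary predicate \<open>P\<close>, so that the set-theoretic
      reduction does not involve the product group operations.\<close>
    have split: "(\<forall>g \<in> ?E - {\<one>\<^bsub>?G\<^esub>}. P g) \<longleftrightarrow> (\<forall>k \<in> carrier G1 - {\<one>\<^bsub>G1\<^esub>}. P (k, \<one>\<^bsub>G2\<^esub>))"
      if "\<And>b. b \<noteq> \<one>\<^bsub>G2\<^esub> \<Longrightarrow> P (\<one>\<^bsub>G1\<^esub>, b)" for P
      using that unfolding E by blast
    have "(\<forall>g \<in> ?E - {\<one>\<^bsub>?G\<^esub>}. \<not> ?dif g) \<longleftrightarrow>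
        (\<forall>k \<in> carrier G1 - {\<one>\<^bsub>G1\<^esub>}. \<not> ?dif (k, \<one>\<^bsub>G2\<^esub>))"
      using one by (rule split)
    also have "\<dots> \<longleftrightarrow> (\<forall>k \<in> carrier G1 - {\<one>\<^bsub>G1\<^esub>}. \<forall>i \<in> carrier G1. ?\<Delta> k i \<noteq> \<one>\<^bsub>G2\<^esub>)"
    proof (rule ball_cong[OF refl])
      fix k assume "k \<in> carrier G1 - {\<one>\<^bsub>G1\<^esub>}"
      then have k: "k \<in> carrier G1" by simp
      show "\<not> ?dif (k, \<one>\<^bsub>G2\<^esub>) \<longleftrightarrow> (\<forall>i \<in> carrier G1. ?\<Delta> k i \<noteq> \<one>\<^bsub>G2\<^esub>)"
        unfolding exists[OF k] by blast
    qed
    finally show ?thesis .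
  qed
  finally show ?thesis
    unfolding ball_conj_distrib by (rule trans[OF _ conj_commute])
qed

theorem theorem4p4:
  fixes G1 :: "('a, 'm) monoid_scheme"
    and G2 :: "('b, 'k) monoid_scheme"
    and n :: nat
    and \<phi> :: "'a \<Rightarrow> 'b"
    and D :: "('a \<times> 'b) set"
  assumes "comm_group G1" and "finite (carrier G1)"
    and "comm_group G2" and "finite (carrier G2)"
    and "order G2 = order G1 + 1" and "order G2 = n" and "n \<ge> 3"
    and "\<phi> \<in> carrier G1 \<rightarrow> carrier G2"
    and "D = {(i, \<phi> i) | i. i \<in> carrier G1}"
  shows "direct_product_difference_set G1 G2 n D \<longleftrightarrow> circular_costas G1 G2 \<phi>"
proof -
  interpret G1: comm_group G1 by fact
  interpret G2: comm_group G2 by fact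
  let ?\<Delta> = "\<lambda>k i. \<phi> (i \<otimes>\<^bsub>G1\<^esub> k) \<otimes>\<^bsub>G2\<^esub> inv\<^bsub>G2\<^esub> \<phi> i"
  let ?K = "carrier G1 - {\<one>\<^bsub>G1\<^esub>}" and ?B = "carrier G2 - {\<one>\<^bsub>G2\<^esub>}"
  have \<phi>: "\<phi> i \<in> carrier G2" if "i \<in> carrier G1" for i
    using assms(8) that by blast
  have \<Delta>_closed: "?\<Delta> k i \<in> carrier G2" if "k \<in> carrier G1" "i \<in> carrier G1" for k i
    using that \<phi> by simp
  have \<Delta>_one: "?\<Delta> k i = \<one>\<^bsub>G2\<^esub> \<longleftrightarrow> \<phi> (i \<otimes>\<^bsub>G1\<^esub> k) = \<phi> i"
    if "k \<in> carrier G1" "i \<in> carrier G1" for k i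
    using that \<phi> by (metis G1.m_closed G2.inv_closed G2.inv_equality G2.inv_inv G2.r_inv)
  \<comment> \<open>Two distinct arguments have the form \<open>i\<close> and \<open>i + k\<close>
    with \<open>k \<noteq> 0\<close>. Injectivity of \<open>\<phi>\<close> is therefore exactly the
    exclusion of the differences \<open>(k, 0)\<close>.\<close>
  have inj: "inj_on \<phi> (carrier G1) \<longleftrightarrow> (\<forall>k\<in>?K. \<forall>i\<in>carrier G1. ?\<Delta> k i \<noteq> \<one>\<^bsub>G2\<^esub>)"
  proof
    assume inj: "inj_on \<phi> (carrier G1)"
    show "\<forall>k\<in>?K. \<forall>i\<in>carrier G1. ?\<Delta> k i \<noteq> \<one>\<^bsub>G2\<^esub>"
    proof (intro ballI)
      fix k i assume "k \<in> ?K" and i: "i \<in> carrier G1"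
      then have k: "k \<in> carrier G1" "k \<noteq> \<one>\<^bsub>G1\<^esub>" by auto
      then show "?\<Delta> k i \<noteq> \<one>\<^bsub>G2\<^esub>"
        unfolding \<Delta>_one[OF k(1) i] using i by (simp add: inj_on_eq_iff[OF inj])
    qed
  next
    assume nz: "\<forall>k\<in>?K. \<forall>i\<in>carrier G1. ?\<Delta> k i \<noteq> \<one>\<^bsub>G2\<^esub>"
    show "inj_on \<phi> (carrier G1)"
    proof (rule inj_onI, rule ccontr)
      fix i j assume ij: "i \<in> carrier G1" "j \<in> carrier G1" "\<phi> i = \<phi> j" "i \<noteq> j"
      \<comment> \<open>The shift from \<open>i\<close> to \<open>j\<close>: a collision of
        \<open>\<phi>\<close> at two distinct points becomes a zero of \<open>?\<Delta> k\<close>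
        with \<open>k \<noteq> 0\<close>.\<close>
      define k where "k = inv\<^bsub>G1\<^esub> i \<otimes>\<^bsub>G1\<^esub> j"
      have k: "k \<in> carrier G1" and j: "i \<otimes>\<^bsub>G1\<^esub> k = j"
        using ij by (simp_all add: k_def G1.m_assoc[symmetric])
      then have "k \<noteq> \<one>\<^bsub>G1\<^esub>" using ij by auto
      moreover have "?\<Delta> k i = \<one>\<^bsub>G2\<^esub>"
        using ij(2,3) \<phi> unfolding j by simp
      ultimately show False using nz k ij(1) by blast
    qed
  qed
  \<comment> \<open>The extra element of \<open>G2\<close> makes up for the removed identity, so the
    two sizes agree exactly.\<close>
  have card: "card ?B = card (carrier G1)"
    using assms(4,5) by (simp add: order_def)
  \<comment> \<open>The hypothesis \<open>nz\<close> is what places the image of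
    \<open>?\<Delta> k\<close> inside \<open>?B\<close>, as the counting lemma requires.\<close>
  have bij: "inj_on (?\<Delta> k) (carrier G1) \<longleftrightarrow> (\<forall>b\<in>?B. \<exists>!i. i \<in> carrier G1 \<and> ?\<Delta> k i = b)"
    if k: "k \<in> carrier G1" and nz: "\<forall>i\<in>carrier G1. ?\<Delta> k i \<noteq> \<one>\<^bsub>G2\<^esub>" for k
    using nz \<Delta>_closed[OF k] assms(4) card by (intro inj_on_iff_ex1) auto
  have "direct_product_difference_set G1 G2 n D \<longleftrightarrow>
      (\<forall>k\<in>?K. (\<forall>i\<in>carrier G1. ?\<Delta> k i \<noteq> \<one>\<^bsub>G2\<^esub>) \<and>
        (\<forall>b\<in>?B. \<exists>!i. i \<in> carrier G1 \<and> ?\<Delta> k i = b))"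
    by (rule direct_product_difference_set_graph_iff[OF assms(1,2) G2.group_axioms assms(4-9)])
  also have "\<dots> \<longleftrightarrow> (\<forall>k\<in>?K. (\<forall>i\<in>carrier G1. ?\<Delta> k i \<noteq> \<one>\<^bsub>G2\<^esub>) \<and>
      inj_on (?\<Delta> k) (carrier G1))"
    \<comment> \<open>\<open>conj_cong\<close> makes the first conjunct available while the second
      is rewritten; it supplies the hypothesis \<open>nz\<close> of \<open>bij\<close>.\<close>
    by (intro ball_cong conj_cong refl bij[symmetric]) simp_all
  also have "\<dots> \<longleftrightarrow> inj_on \<phi> (carrier G1) \<and> (\<forall>k\<in>?K. inj_on (?\<Delta> k) (carrier G1))"
    unfolding inj by (rule ball_conj_distrib)
  also have "\<dots> \<longleftrightarrow> circular_costas G1 G2 \<phi>"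
    unfolding circular_costas_def using assms(1-5,8) by simp
  finally show ?thesis .
qed

end
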